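(* Let $I\subset\mathbb{R}$ be an open interval, $n,q\in\mathbb{N}$, $\alpha,\beta\in\,]-1,+\infty[$, $h>0$ and $f\in C^{n+1}(I)$. Then $$\forall x\in I_h,\quad D^{(n)}_{h,\alpha,\beta,q}f(x)=\sum_{i=0}^{q}P_i^{(\alpha+n,\beta+n)}(0)\,\frac{2i+\alpha+\beta+2n+1}{i+\alpha+\beta+2n+1}\sum_{j=0}^{i}(-1)^{i+j}\binom{i}{j}D^{(n)}_{h,\alpha_{i,j},\beta_j}f(x),$$ where $\alpha_{i,j}=\alpha+i-j$ and $\beta_j=\beta+j$. Moreover, $$\sum_{i=0}^{q}P_i^{(\alpha+n,\beta+n)}(0)\,\frac{2i+\alpha+\beta+2n+1}{i+\alpha+\beta+2n+1}\sum_{j=0}^{i}(-1)^{i+j}\binom{i}{j}=1.$$ (For $i=0$ the quotient $\frac{2i+\alpha+\beta+2n+1}{i+\alpha+\beta+2n+1}$ is understood as $1$.)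
   Context: $\mathbb{N}$ includes $0$. For $h>0$, $I_h:=\{x\in I:\ [x-h,x+h]\subset I\}$. For $\alpha,\beta>-1$: $P_n^{(\alpha,\beta)}(t)=\sum_{j=0}^{n}\binom{n+\alpha}{j}\binom{n+\beta}{n-j}\left(\frac{t-1}{2}\right)^{n-j}\left(\frac{t+1}{2}\right)^{j}$ is the $n$-th Jacobi polynomial, $w_{\alpha,\beta}(t)=(1-t)^{\alpha}(1+t)^{\beta}$, $\langle g_1(\cdot),g_2(\cdot)\rangle_{\alpha,\beta}=\int_{-1}^{1}w_{\alpha,\beta}(t)g_1(t)g_2(t)\,dt$ for $g_1,g_2\in C^0([-1,1])$, and $\|\cdot\|_{\alpha,\beta}$ is the associated norm. With $B(a,b)=\Gamma(a)\Gamma(b)/\Gamma(a+b)$, $$\rho_{n,\alpha,\beta}(t)=\frac{2^{-(n+\alpha+\beta+1)}\,n!}{B(n+\alpha+1,n+\beta+1)}P_n^{(\alpha,\beta)}(t)\,w_{\alpha,\beta}(t).$$ The minimal estimators are $D^{(n)}_{h,\alpha,\beta}f(x)=\frac{1}{h^{n}}\int_{-1}^{1}\rho_{n,\alpha,\beta}(t)f(x+ht)\,dt$ for $x\in I_h$. The affine estimators (value at $t=0$ of the $q$-th order truncated Jacobi series of $t\mapsto f^{(n)}(x+ht)$) are, for $x\in I_h$, $$D^{(n)}_{h,\alpha,\beta,q}f(x)=\sum_{i=0}^{q}\frac{\left\langle P_i^{(\alpha+n,\beta+n)}(\cdot),f^{(n)}(x+h\,\cdot)\right\rangle_{\alpha+n,\beta+n}}{\|P_i^{(\alpha+n,\beta+n)}\|^2_{\alpha+n,\beta+n}}\,P_i^{(\alpha+n,\beta+n)}(0).$$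 *)

theory Defs
  imports "HOL-Analysis.Analysis"
begin

text \<open>
  Only used for open \<open>S\<close>, where the iterated \<^const>\<open>deriv\<close> at a point of \<open>S\<close> depends only on
  the restriction of \<open>f\<close> to \<open>S\<close>.
\<close>
definition Ck_on :: "nat \<Rightarrow> (real \<Rightarrow> real) \<Rightarrow> real set \<Rightarrow> bool" where
  "Ck_on k f S \<longleftrightarrow>
     (\<forall>j<k. \<forall>x\<in>S. (deriv ^^ j) f differentiable (at x)) \<and> continuous_on S ((deriv ^^ k) f)"

definition shrink_interval :: "real \<Rightarrow> real set \<Rightarrow> real set" where
  "shrink_interval h I = {x \<in> I. {x - h..x + h} \<subseteq> I}"

definition jacobi_P :: "real \<Rightarrow> real \<Rightarrow> nat \<Rightarrow> real \<Rightarrow> real" where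
  "jacobi_P \<alpha> \<beta> n t =
     (\<Sum>j=0..n. ((real n + \<alpha>) gchoose j) * ((real n + \<beta>) gchoose (n - j))
        * ((t - 1) / 2) ^ (n - j) * ((t + 1) / 2) ^ j)"

text \<open>
  At an endpoint of \<open>[-1, 1]\<close> the convention \<open>0 powr a = 0\<close> may differ from the
  usual value of the weight; all uses are under an integral, where this is immaterial.
\<close>
definition jacobi_weight :: "real \<Rightarrow> real \<Rightarrow> real \<Rightarrow> real" where
  "jacobi_weight \<alpha> \<beta> t = (1 - t) powr \<alpha> * (1 + t) powr \<beta>"

definition jacobi_inner :: "real \<Rightarrow> real \<Rightarrow> (real \<Rightarrow> real) \<Rightarrow> (real \<Rightarrow> real) \<Rightarrow> real" where
  "jacobi_inner \<alpha> \<beta> g\<^sub>1 g\<^sub>2 = integral {-1..1} (\<lambda>t. jacobi_weight \<alpha> \<beta> t * g\<^sub>1 t * g\<^sub>2 t)"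

definition jacobi_norm :: "real \<Rightarrow> real \<Rightarrow> (real \<Rightarrow> real) \<Rightarrow> real" where
  "jacobi_norm \<alpha> \<beta> g = sqrt (jacobi_inner \<alpha> \<beta> g g)"

definition jacobi_rho :: "nat \<Rightarrow> real \<Rightarrow> real \<Rightarrow> real \<Rightarrow> real" where
  "jacobi_rho n \<alpha> \<beta> t =
     2 powr (- (real n + \<alpha> + \<beta> + 1)) * fact n / Beta (real n + \<alpha> + 1) (real n + \<beta> + 1)
       * jacobi_P \<alpha> \<beta> n t * jacobi_weight \<alpha> \<beta> t"

definition minimal_estimator ::
  "nat \<Rightarrow> real \<Rightarrow> real \<Rightarrow> real \<Rightarrow> (real \<Rightarrow> real) \<Rightarrow> real \<Rightarrow> real" where
  "minimal_estimator n h \<alpha> \<beta> f x =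
     1 / h ^ n * integral {-1..1} (\<lambda>t. jacobi_rho n \<alpha> \<beta> t * f (x + h * t))"

definition affine_estimator ::
  "nat \<Rightarrow> real \<Rightarrow> real \<Rightarrow> real \<Rightarrow> nat \<Rightarrow> (real \<Rightarrow> real) \<Rightarrow> real \<Rightarrow> real" where
  "affine_estimator n h \<alpha> \<beta> q f x =
     (\<Sum>i=0..q.
        jacobi_inner (\<alpha> + real n) (\<beta> + real n) (jacobi_P (\<alpha> + real n) (\<beta> + real n) i)
            (\<lambda>t. (deriv ^^ n) f (x + h * t))
          / (jacobi_norm (\<alpha> + real n) (\<beta> + real n) (jacobi_P (\<alpha> + real n) (\<beta> + real n) i))\<^sup>2
          * jacobi_P (\<alpha> + real n) (\<beta> + real n) i 0)"

text \<open>
  The quotient is taken to be \<open>1\<close> for \<open>i = 0\<close>, also when its denominator vanishes there,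
  which happens for \<open>n = 0\<close> and \<open>\<alpha> + \<beta> = -1\<close>.
\<close>
definition affine_quotient :: "nat \<Rightarrow> real \<Rightarrow> real \<Rightarrow> nat \<Rightarrow> real" where
  "affine_quotient n \<alpha> \<beta> i =
     (if i = 0 then 1
      else (2 * real i + \<alpha> + \<beta> + 2 * real n + 1) / (real i + \<alpha> + \<beta> + 2 * real n + 1))"

end

theory Submission
  imports Defs
begin

text \<open>
  Write \<open>w a b\<close> for the Jacobi weight, \<open>a = \<alpha> + n\<close>, \<open>b = \<beta> + n\<close>, and let
  \<open>g\<close> be the function \<open>t \<mapsto> (deriv ^^ n) f (x + h t)\<close>. Both kinds of estimators turn out to be built from the
  means of \<open>g\<close> against Beta densities, that is, against the weights \<open>w a' b'\<close> divided by their total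
  masses; such a mean is called \<open>jacobi_mean a' b' g\<close> below.

  A minimal estimator is a single mean. Its kernel \<open>w \<alpha> \<beta> P\<^sub>n\<close> is, by the formula of Rodrigues, an
  \<open>n\<close>-th derivative of \<open>w (\<alpha> + n) (\<beta> + n)\<close>, so \<open>n\<close> integrations by parts move all derivatives to \<open>f\<close>;
  no boundary terms appear, because each antiderivative contains a weight with positive exponents
  (\<open>jacobi_integration_by_parts\<close>, \<open>minimal_estimator_eq_jacobi_mean\<close>).

  A Jacobi coefficient of \<open>g\<close> is an alternating combination of means. The definition of \<open>P\<^sub>i\<close> is
  homogeneous in \<open>1 - t\<close> and \<open>1 + t\<close>, so \<open>w a b P\<^sub>i\<close> is an alternating sum of the weights
  \<open>w (a + i - j) (b + j)\<close>. The factors \<open>1 / \<Gamma>(\<dots>)\<close> in the two binomial coefficients of the \<open>j\<close>-th term are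
  exactly cancelled by the total mass of the \<open>j\<close>-th weight, and what remains is \<open>i choose j\<close> times
  a factor that does not depend on \<open>j\<close> (\<open>integral_jacobi_P_eq_alternating_means\<close>).

  Dividing that factor by the squared norm of \<open>P\<^sub>i\<close> leaves \<open>(2i + a + b + 1) / (i + a + b + 1)\<close>. The norm
  itself comes from the same integration by parts, now with \<open>P\<^sub>i\<close> in the role of \<open>g\<close>: the \<open>i\<close>-th derivative
  of \<open>P\<^sub>i\<close> is the constant \<open>i!\<close> times its leading coefficient, which Vandermonde's identity evaluates
  (\<open>jacobi_norm_squared\<close>).

  Finally, the coefficients sum to one because an alternating row of Pascal's triangle sums to zero
  unless it is the row \<open>i = 0\<close>.
\<close>

section \<open>The Jacobi weight and its products with Jacobi polynomials\<close>

lemma jacobi_weight_nonneg: "0 \<le> jacobi_weight a b t"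
  by (simp add: jacobi_weight_def)

lemma powr_times_power:
  fixes u a :: real
  assumes "0 \<le> u"
  shows "u powr a * u ^ k = u powr (a + real k)"
  using assms by (cases "u = 0") (auto simp: powr_add powr_realpow)

text \<open>
  Multiplying by powers of \<open>1 - t\<close> and \<open>1 + t\<close> shifts the exponents of the weight. The endpoints need no
  exception: \<open>0 powr a = 0\<close> for every \<open>a\<close>, so there both sides vanish.
\<close>
lemma jacobi_weight_times_powers:
  assumes "t \<in> {-1..1}"
  shows "jacobi_weight a b t * (1 - t) ^ k * (1 + t) ^ l = jacobi_weight (a + real k) (b + real l) t"
proof -
  have "(1 - t) powr a * (1 - t) ^ k = (1 - t) powr (a + real k)"
    and "(1 + t) powr b * (1 + t) ^ l = (1 + t) powr (b + real l)"
    using assms by (simp_all add: powr_times_power)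
  then show ?thesis
    unfolding jacobi_weight_def by (metis mult.assoc mult.left_commute)
qed

text \<open>
  The \<open>j\<close>-th term of the Jacobi polynomial is a multiple of \<open>(1 - t)\<^bsup>n-j\<^esup> (1 + t)\<^bsup>j\<^esup>\<close>, which the weight absorbs.
\<close>
lemma jacobi_weight_times_P:
  assumes "t \<in> {-1..1}"
  shows "jacobi_weight a b t * jacobi_P a b n t =
    (\<Sum>j=0..n. (-1) ^ (n - j) * ((real n + a) gchoose j) * ((real n + b) gchoose (n - j))
        * jacobi_weight (a + real (n - j)) (b + real j) t) / 2 ^ n"
proof -
  have "jacobi_weight a b t * (((real n + a) gchoose j) * ((real n + b) gchoose (n - j))
        * ((t - 1) / 2) ^ (n - j) * ((t + 1) / 2) ^ j)
      = (-1) ^ (n - j) * ((real n + a) gchoose j) * ((real n + b) gchoose (n - j))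
        * jacobi_weight (a + real (n - j)) (b + real j) t / 2 ^ n" if "j \<in> {0..n}" for j
  proof -
    have "(t - 1) ^ (n - j) = (-1) ^ (n - j) * (1 - t) ^ (n - j)"
      by (simp flip: power_mult_distrib)
    moreover have "(2::real) ^ n = 2 ^ (n - j) * 2 ^ j"
      using that by (simp flip: power_add)
    ultimately show ?thesis
      unfolding jacobi_weight_times_powers[OF assms, symmetric] power_divide
      by (simp add: add.commute[of t] mult_ac)
  qed
  then show ?thesis
    by (simp add: jacobi_P_def sum_distrib_left sum_divide_distrib)
qed

text \<open>
  Euler's Beta integral, transported from \<open>[0, 1]\<close> to \<open>[-1, 1]\<close> by \<open>s = (t + 1) / 2\<close>.
\<close>
lemma has_integral_jacobi_weight:
  assumes "-1 < a" "-1 < b"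
  shows "(jacobi_weight a b has_integral 2 powr (a + b + 1) * Beta (a + 1) (b + 1)) {-1..1}"
proof -
  have "((\<lambda>s. s powr b * (1 - s) powr a) has_integral Beta (b + 1) (a + 1)) (cbox 0 1)"
    using has_integral_Beta_real[of "b + 1" "a + 1"] assms by simp
  from has_integral_affinity'[OF this, of "1/2" "1/2"]
  have "((\<lambda>t. (t / 2 + 1 / 2) powr b * (1 / 2 - t / 2) powr a) has_integral
           2 * Beta (b + 1) (a + 1)) {-1..1}"
    by simp
  from has_integral_mult_right[OF this, of "2 powr (a + b)"]
  have *: "((\<lambda>t. 2 powr (a + b) * ((t / 2 + 1 / 2) powr b * (1 / 2 - t / 2) powr a)) has_integral
           2 powr (a + b + 1) * Beta (a + 1) (b + 1)) {-1..1}"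
    by (simp add: powr_add Beta_commute mult_ac)
  show ?thesis
  proof (rule has_integral_eq[OF _ *])
    fix t :: real assume t: "t \<in> {-1..1}"
    have "(t / 2 + 1 / 2) powr b = (1 + t) powr b / 2 powr b"
      using t by (subst powr_divide[symmetric]) (auto simp: field_simps)
    moreover have "(1 / 2 - t / 2) powr a = (1 - t) powr a / 2 powr a"
      using t by (subst powr_divide[symmetric]) (auto simp: field_simps)
    ultimately show "2 powr (a + b) * ((t / 2 + 1 / 2) powr b * (1 / 2 - t / 2) powr a)
        = jacobi_weight a b t"
      by (simp add: jacobi_weight_def powr_add)
  qed
qed

lemma jacobi_weight_times_continuous_integrable:
  assumes "-1 < a" "-1 < b" "continuous_on {-1..1} g"
  shows "(\<lambda>t. jacobi_weight a b t * g t) integrable_on {-1..1}"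
proof -
  have "jacobi_weight a b absolutely_integrable_on {-1..1}"
    using has_integral_jacobi_weight[OF assms(1,2)] jacobi_weight_nonneg
    by (intro nonnegative_absolutely_integrable_1) (auto simp: integrable_on_def)
  moreover have "bounded (g ` {-1..1})"
    using assms(3) by (intro compact_imp_bounded compact_continuous_image) auto
  moreover have "g \<in> borel_measurable (lebesgue_on {-1..1})"
    using assms(3) by (intro continuous_imp_measurable_on_sets_lebesgue) auto
  ultimately have "(\<lambda>t. g t * jacobi_weight a b t) absolutely_integrable_on {-1..1}"
    by (intro absolutely_integrable_bounded_measurable_product_real) auto
  then show ?thesis
    by (auto simp: mult.commute dest: absolutely_integrable_on_def[THEN iffD1])
qed

section \<open>The formula of Rodrigues and integration by parts\<close>

lemma jacobi_weight_has_derivative: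
  assumes "t \<in> {-1<..<1}"
  shows "(jacobi_weight (a + 1) (b + 1) has_real_derivative
     (b + 1) * jacobi_weight (a + 1) b t - (a + 1) * jacobi_weight a (b + 1) t) (at t)"
proof -
  have "((\<lambda>t. (1 - t) powr (a + 1)) has_real_derivative - ((a + 1) * (1 - t) powr a)) (at t)"
    using DERIV_fun_powr[of "\<lambda>t. 1 - t" "-1" t "a + 1"] assms
    by (auto intro!: derivative_eq_intros)
  moreover have "((\<lambda>t. (1 + t) powr (b + 1)) has_real_derivative (b + 1) * (1 + t) powr b) (at t)"
    using DERIV_fun_powr[of "\<lambda>t. 1 + t" 1 t "b + 1"] assms
    by (auto intro!: derivative_eq_intros)
  ultimately show ?thesis
    unfolding jacobi_weight_def[abs_def] by (rule DERIV_cong[OF DERIV_mult]) (simp add: algebra_simps)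
qed

lemma jacobi_weight_continuous_on:
  assumes "0 < a" "0 < b"
  shows "continuous_on {-1..1} (jacobi_weight a b)"
  unfolding jacobi_weight_def using assms by (intro continuous_intros continuous_on_powr') auto

lemma jacobi_P_continuous_on:
  "continuous_on S (jacobi_P a b n)"
  unfolding jacobi_P_def by (intro continuous_intros) auto

text \<open>
  One step of the formula of Rodrigues. Differentiating the expansion of \<open>w (a + 1) (b + 1) P\<^sub>m\<close> termwise
  splits the \<open>j\<close>-th term into two, in which one exponent has dropped by one. The terms of the expansion
  of \<open>w a b P\<^bsub>m+1\<^esub>\<close>, called \<open>U j\<close> in the proof up to a common factor, receive the factor \<open>m + 1 - j\<close> from one
  side and \<open>j\<close> from the other, hence the factor \<open>m + 1\<close> in total.
\<close>
lemma jacobi_weight_times_P_has_derivative: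
  assumes t: "t \<in> {-1<..<1}"
  shows "((\<lambda>t. jacobi_weight (a + 1) (b + 1) t * jacobi_P (a + 1) (b + 1) m t) has_real_derivative
     - 2 * real (m + 1) * (jacobi_weight a b t * jacobi_P a b (m + 1) t)) (at t)"
proof -
  define X where "X j = (real (m + 1) + a) gchoose j" for j
  define Y where "Y j = (real (m + 1) + b) gchoose j" for j
  define U where "U j = (-1) ^ (m + 1 - j) * X j * Y (m + 1 - j)
    * jacobi_weight (a + real (m + 1 - j)) (b + real j) t" for j
  \<comment> \<open>The exponent produced by differentiation completes a binomial coefficient to the next one.\<close>
  have X: "(real (m - j) + a + 1) * X j = real (j + 1) * X (j + 1)" if "j \<le> m" for j
    using gbinomial_mult_1[of "real (m + 1) + a" j] that by (simp add: X_def of_nat_diff algebra_simps)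
  have Y: "(real j + b + 1) * Y (m - j) = real (m + 1 - j) * Y (m + 1 - j)" if "j \<le> m" for j
    using gbinomial_mult_1[of "real (m + 1) + b" "m - j"] that
    by (simp add: Y_def of_nat_diff Suc_diff_le algebra_simps)
  let ?c = "\<lambda>j. (-1) ^ (m - j) * X j * Y (m - j)"
  let ?D = "\<lambda>j. (b + real j + 1) * jacobi_weight (a + real (m - j) + 1) (b + real j) t
       - (a + real (m - j) + 1) * jacobi_weight (a + real (m - j)) (b + real j + 1) t"
  have "((\<lambda>t. (\<Sum>j=0..m. ?c j * jacobi_weight (a + real (m - j) + 1) (b + real j + 1) t) / 2 ^ m)
      has_real_derivative (\<Sum>j=0..m. ?c j * ?D j) / 2 ^ m) (at t)"
    by (intro DERIV_cdivide DERIV_sum DERIV_cmult jacobi_weight_has_derivative t)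
  moreover have D: "(\<Sum>j=0..m. ?c j * ?D j) = - (real (m + 1) * (\<Sum>j=0..m+1. U j))"
  proof -
    have "?c j * ?D j = - (real (m + 1 - j) * U j) - real (j + 1) * U (j + 1)" if "j \<in> {0..m}" for j
    proof -
      have j: "j \<le> m" using that by simp
      define W V where "W = jacobi_weight (a + real (m - j) + 1) (b + real j) t"
        and "V = jacobi_weight (a + real (m - j)) (b + real j + 1) t"
      have 1: "U j = - ((-1) ^ (m - j) * X j * Y (m + 1 - j) * W)"
        using j by (simp add: U_def W_def Suc_diff_le add_ac)
      have 2: "U (j + 1) = (-1) ^ (m - j) * X (j + 1) * Y (m - j) * V"
        by (simp add: U_def V_def add_ac)
      have "?c j * ?D j = (-1) ^ (m - j) * X j * W * ((real j + b + 1) * Y (m - j))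
          - (-1) ^ (m - j) * Y (m - j) * V * ((real (m - j) + a + 1) * X j)"
        unfolding W_def[symmetric] V_def[symmetric] by (simp add: algebra_simps)
      also have "\<dots> = - (real (m + 1 - j) * U j) - real (j + 1) * U (j + 1)"
        unfolding X[OF j] Y[OF j] 1 2 by simp
      finally show ?thesis .
    qed
    then have "(\<Sum>j=0..m. ?c j * ?D j)
        = - (\<Sum>j=0..m. real (m + 1 - j) * U j) - (\<Sum>j=0..m. real (j + 1) * U (j + 1))"
      by (simp add: sum_subtractf sum_negf del: of_nat_Suc)
    also have "(\<Sum>j=0..m. real (m + 1 - j) * U j) = (\<Sum>j=0..m+1. real (m + 1 - j) * U j)"
      by simp
    also have "(\<Sum>j=0..m. real (j + 1) * U (j + 1)) = (\<Sum>j=0..m+1. real j * U j)"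
      by (simp add: sum.atLeast0_atMost_Suc_shift del: sum.cl_ivl_Suc)
    also have "- (\<Sum>j=0..m+1. real (m + 1 - j) * U j) - (\<Sum>j=0..m+1. real j * U j)
        = - (\<Sum>j=0..m+1. real (m + 1) * U j)"
      unfolding sum_negf[symmetric] sum_subtractf[symmetric]
      by (intro sum.cong refl) (auto simp: of_nat_diff algebra_simps)
    finally show ?thesis
      by (simp only: sum_distrib_left)
  qed
  moreover have U: "(\<Sum>j=0..m+1. U j) = 2 ^ (m + 1) * (jacobi_weight a b t * jacobi_P a b (m + 1) t)"
    using t by (subst jacobi_weight_times_P) (auto simp: U_def X_def Y_def)
  then have "(\<Sum>j=0..m. ?c j * ?D j) / 2 ^ m
      = - 2 * real (m + 1) * (jacobi_weight a b t * jacobi_P a b (m + 1) t)"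
  proof -
    have "- (real (m + 1) * (2 ^ (m + 1) * V)) / 2 ^ m = - 2 * real (m + 1) * V" for V :: real
      by (simp add: field_simps)
    then show ?thesis
      unfolding D U .
  qed
  ultimately have "((\<lambda>t. (\<Sum>j=0..m. ?c j * jacobi_weight (a + real (m - j) + 1) (b + real j + 1) t) / 2 ^ m)
      has_real_derivative - 2 * real (m + 1) * (jacobi_weight a b t * jacobi_P a b (m + 1) t)) (at t)"
    by simp
  then show ?thesis
  proof (rule has_field_derivative_transform_within_open[OF _ open_greaterThanLessThan t])
    fix s :: real assume "s \<in> {-1<..<1}"
    then show "(\<Sum>j=0..m. ?c j * jacobi_weight (a + real (m - j) + 1) (b + real j + 1) s) / 2 ^ m
        = jacobi_weight (a + 1) (b + 1) s * jacobi_P (a + 1) (b + 1) m s"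
      by (subst jacobi_weight_times_P) (auto simp: X_def Y_def add_ac)
  qed
qed

text \<open>
  The \<open>n\<close>-fold iteration, for a sequence \<open>g\<close> of successive derivatives. Each step raises both
  exponents by one. The weight \<open>w a b\<close> may be unbounded near the endpoints, but its antiderivative \<open>F\<close>
  carries the exponents \<open>a + 1\<close> and \<open>b + 1\<close>, which are positive: \<open>F\<close> is continuous on the closed interval
  and vanishes at its ends, so that no boundary terms remain.
\<close>
lemma jacobi_integration_by_parts:
  assumes "-1 < a" "-1 < b"
    and deriv: "\<And>k t. k < n \<Longrightarrow> t \<in> {-1..1} \<Longrightarrow> (g k has_real_derivative g (Suc k) t) (at t)"
    and cont: "continuous_on {-1..1} (g n)"
  shows "((\<lambda>t. jacobi_weight a b t * jacobi_P a b n t * g 0 t) has_integral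
     integral {-1..1} (\<lambda>t. jacobi_weight (a + real n) (b + real n) t * g n t) / (2 ^ n * fact n)) {-1..1}"
  using assms
proof (induction n arbitrary: a b g)
  case 0
  then show ?case
    using jacobi_weight_times_continuous_integrable[of a b "g 0"]
    by (simp add: jacobi_P_def integrable_integral)
next
  case (Suc m)
  define F where "F t = jacobi_weight (a + 1) (b + 1) t * jacobi_P (a + 1) (b + 1) m t" for t
  define J where "J = integral {-1..1} (\<lambda>t. jacobi_weight (a + real (Suc m)) (b + real (Suc m)) t * g (Suc m) t)"
  have "((\<lambda>t. F t * g 1 t) has_integral J / (2 ^ m * fact m)) {-1..1}"
    using Suc.IH[of "a + 1" "b + 1" "\<lambda>k. g (Suc k)"] Suc.prems
    by (simp add: F_def J_def add_ac)
  moreover have "F 1 = 0" "F (-1) = 0"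
    by (simp_all add: F_def jacobi_weight_def)
  ultimately have "((\<lambda>t. F t * g 1 t) has_integral F 1 * g 0 1 - F (-1) * g 0 (-1)
      - (- (J / (2 ^ m * fact m)))) {-1..1}"
    by simp
  have "((\<lambda>t. - 2 * real (m + 1) * (jacobi_weight a b t * jacobi_P a b (m + 1) t) * g 0 t)
      has_integral - (J / (2 ^ m * fact m))) {-1..1}"
  proof (rule integration_by_parts_interior[OF bounded_bilinear_mult])
    show "continuous_on {-1..1} F"
      unfolding F_def using Suc.prems(1,2)
      by (intro continuous_on_mult jacobi_P_continuous_on jacobi_weight_continuous_on) auto
    show "continuous_on {-1..1} (g 0)"
      using Suc.prems(3)[of 0] by (intro DERIV_continuous_on) (auto intro: DERIV_subset)
    show "(F has_vector_derivative
        - 2 * real (m + 1) * (jacobi_weight a b t * jacobi_P a b (m + 1) t)) (at t)"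
      if "t \<in> {-1<..<1}" for t
      using jacobi_weight_times_P_has_derivative[OF that]
      unfolding F_def has_real_derivative_iff_has_vector_derivative .
    show "(g 0 has_vector_derivative g 1 t) (at t)" if "t \<in> {-1<..<1}" for t
      using Suc.prems(3)[of 0 t] that
      by (simp flip: has_real_derivative_iff_has_vector_derivative)
  qed (simp, fact)
  from has_integral_mult_right[OF this, of "- (1 / (2 * real (m + 1)))"]
  have "((\<lambda>t. jacobi_weight a b t * jacobi_P a b (m + 1) t * g 0 t)
      has_integral - (1 / (2 * real (m + 1))) * - (J / (2 ^ m * fact m))) {-1..1}"
    by (rule has_integral_eq[rotated]) (simp del: of_nat_Suc of_nat_add)
  also have "- (1 / (2 * real (m + 1))) * - (J / (2 ^ m * fact m)) = J / (2 ^ Suc m * fact (Suc m))"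
    by (simp add: mult_ac)
  finally show ?case
    by (simp add: J_def)
qed

section \<open>Jacobi coefficients as alternating sums of means\<close>

text \<open>
  The expectation of \<open>g\<close> under the Beta distribution with parameters \<open>b + 1\<close> and \<open>a + 1\<close>, transported to
  \<open>[-1, 1]\<close>.
\<close>
definition jacobi_mean :: "real \<Rightarrow> real \<Rightarrow> (real \<Rightarrow> real) \<Rightarrow> real" where
  "jacobi_mean a b g = integral {-1..1} (\<lambda>t. jacobi_weight a b t * g t)
     / (2 powr (a + b + 1) * Beta (a + 1) (b + 1))"

text \<open>
  The squared norm of the \<open>i\<close>-th Jacobi polynomial is classically
  \<open>2\<^bsup>a+b+1\<^esup> \<Gamma>(i+a+1) \<Gamma>(i+b+1) / ((2i+a+b+1) i! \<Gamma>(i+a+b+1))\<close>. The normalizer has \<open>\<Gamma>(i+a+b+2)\<close> in place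
  of \<open>(2i+a+b+1) \<Gamma>(i+a+b+1)\<close> and omits the power of two. In this form it is defined also for \<open>i = 0\<close> with
  \<open>a + b = -1\<close>, and apart from the power of two it is the squared norm times the affine quotient.
\<close>
definition jacobi_normalizer :: "real \<Rightarrow> real \<Rightarrow> nat \<Rightarrow> real" where
  "jacobi_normalizer a b i =
     Gamma (real i + a + 1) * Gamma (real i + b + 1) / (fact i * Gamma (real i + a + b + 2))"

lemma Gamma_pos_nonzero: "0 < x \<Longrightarrow> Gamma x \<noteq> 0" for x :: real
  using Gamma_real_pos[of x] by linarith

lemma pos_notin_nonpos_Ints: "0 < x \<Longrightarrow> x \<notin> \<int>\<^sub>\<le>\<^sub>0" for x :: real
  by (auto elim!: nonpos_Ints_cases')

lemma gbinomial_Gamma_pos: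
  fixes z :: real
  assumes "-1 < z"
  shows "z gchoose k = Gamma (z + 1) / (fact k * Gamma (z - real k + 1))"
  using gbinomial_Gamma[of z k] pos_notin_nonpos_Ints[of "z + 1"] assms by simp

lemma Beta_pos: "0 < a \<Longrightarrow> 0 < b \<Longrightarrow> 0 < Beta a b" for a b :: real
  by (simp add: Beta_def)

lemma jacobi_normalizer_nonzero:
  assumes "-1 < a" "-1 < b"
  shows "jacobi_normalizer a b i \<noteq> 0"
  using assms by (auto simp: jacobi_normalizer_def Gamma_pos_nonzero)

text \<open>
  This cancellation is why binomial coefficients appear in the affine estimator: the Gamma factors
  of the coefficient that depend on \<open>j\<close> are those of the total mass of \<open>w (a + i - j) (b + j)\<close>, and
  only \<open>j! (i - j)!\<close> survives.
\<close>
lemma jacobi_coefficient_times_Beta: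
  assumes "-1 < a" "-1 < b" and j: "j \<le> i"
  shows "((real i + a) gchoose j) * ((real i + b) gchoose (i - j))
      * Beta (a + real (i - j) + 1) (b + real j + 1)
    = jacobi_normalizer a b i * real (i choose j)"
proof -
  have X: "(real i + a) gchoose j = Gamma (real i + a + 1) / (fact j * Gamma (a + real (i - j) + 1))"
    using assms gbinomial_Gamma_pos[of "real i + a" j] by (simp add: of_nat_diff algebra_simps)
  have Y: "(real i + b) gchoose (i - j) = Gamma (real i + b + 1) / (fact (i - j) * Gamma (b + real j + 1))"
    using assms gbinomial_Gamma_pos[of "real i + b" "i - j"] by (simp add: of_nat_diff algebra_simps)
  have Z: "Beta (a + real (i - j) + 1) (b + real j + 1)
      = Gamma (a + real (i - j) + 1) * Gamma (b + real j + 1) / Gamma (real i + a + b + 2)"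
    using j by (simp add: Beta_def of_nat_diff algebra_simps)
  have "Gamma (a + real (i - j) + 1) \<noteq> 0" "Gamma (b + real j + 1) \<noteq> 0"
    using assms by (auto intro!: Gamma_pos_nonzero)
  then show ?thesis
    unfolding X Y Z jacobi_normalizer_def binomial_fact[OF j] by (simp add: field_simps)
qed

lemma integral_jacobi_P_eq_alternating_means:
  assumes "-1 < a" "-1 < b" and g: "continuous_on {-1..1} g"
  shows "integral {-1..1} (\<lambda>t. jacobi_weight a b t * jacobi_P a b i t * g t)
    = 2 powr (a + b + 1) * jacobi_normalizer a b i
      * (\<Sum>j=0..i. (-1) ^ (i + j) * real (i choose j) * jacobi_mean (a + real i - real j) (b + real j) g)"
proof -
  let ?C = "\<lambda>j. ((real i + a) gchoose j) * ((real i + b) gchoose (i - j))"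
  let ?w = "\<lambda>j. jacobi_weight (a + real (i - j)) (b + real j)"
  have "integral {-1..1} (\<lambda>t. jacobi_weight a b t * jacobi_P a b i t * g t)
      = integral {-1..1} (\<lambda>t. \<Sum>j=0..i. (-1) ^ (i - j) * ?C j / 2 ^ i * (?w j t * g t))"
    by (intro integral_cong)
      (simp add: jacobi_weight_times_P sum_divide_distrib sum_distrib_left sum_distrib_right mult_ac)
  also have "\<dots> = (\<Sum>j=0..i. (-1) ^ (i - j) * ?C j / 2 ^ i * integral {-1..1} (\<lambda>t. ?w j t * g t))"
    using assms
    by (subst integral_sum)
      (auto intro!: integrable_on_mult_right jacobi_weight_times_continuous_integrable)
  also have "\<dots> = (\<Sum>j=0..i. 2 powr (a + b + 1) * jacobi_normalizer a b i
      * ((-1) ^ (i + j) * real (i choose j) * jacobi_mean (a + real i - real j) (b + real j) g))"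
  proof (intro sum.cong refl)
    fix j assume "j \<in> {0..i}"
    then have j: "j \<le> i" by simp
    define B where "B = Beta (a + real (i - j) + 1) (b + real j + 1)"
    have "B \<noteq> 0"
      using assms Beta_pos[of "a + real (i - j) + 1" "b + real j + 1"] by (simp add: B_def)
    have shift: "a + real i - real j = a + real (i - j)"
      using j by (simp add: of_nat_diff)
    have powers: "2 powr (a + real (i - j) + (b + real j) + 1) = 2 powr (a + b + 1) * 2 ^ i"
      using j by (simp add: of_nat_diff powr_realpow[symmetric] flip: powr_add) (simp add: algebra_simps)
    have "integral {-1..1} (\<lambda>t. ?w j t * g t)
        = 2 powr (a + b + 1) * 2 ^ i * B * jacobi_mean (a + real i - real j) (b + real j) g"
      unfolding jacobi_mean_def shift powers B_def[symmetric] using \<open>B \<noteq> 0\<close> by simp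
    moreover have "?C j * B = jacobi_normalizer a b i * real (i choose j)"
      using jacobi_coefficient_times_Beta[OF assms(1,2) j] by (simp add: B_def)
    moreover have "(-1 :: real) ^ (i - j) = (-1) ^ (i + j)"
      using j by (simp add: minus_one_power_iff)
    ultimately show "(-1) ^ (i - j) * ?C j / 2 ^ i * integral {-1..1} (\<lambda>t. ?w j t * g t)
      = 2 powr (a + b + 1) * jacobi_normalizer a b i
        * ((-1) ^ (i + j) * real (i choose j) * jacobi_mean (a + real i - real j) (b + real j) g)"
      by (simp add: mult_ac)
  qed
  finally show ?thesis
    by (simp add: sum_distrib_left)
qed

section \<open>The norm of a Jacobi polynomial\<close>

lemma jacobi_P_as_poly:
  obtains p where "poly p = jacobi_P a b n" "degree p \<le> n"
    "coeff p n = ((2 * real n + a + b) gchoose n) / 2 ^ n"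
proof -
  define q where "q j = [:- 1 / 2, 1 / 2 :: real:] ^ (n - j) * [:1 / 2, 1 / 2:] ^ j" for j
  define p where "p = (\<Sum>j=0..n. smult (((real n + a) gchoose j) * ((real n + b) gchoose (n - j))) (q j))"
  have q: "degree (q j) = n" "coeff (q j) n = 1 / 2 ^ n" if "j \<le> n" for j
  proof -
    show d: "degree (q j) = n"
      using that by (simp add: q_def degree_mult_eq degree_power_eq)
    have "lead_coeff (q j) = (1 / 2) ^ (n - j) * (1 / 2) ^ j"
      by (simp add: q_def lead_coeff_mult lead_coeff_power)
    also have "\<dots> = (1 / 2) ^ n"
      using that by (simp flip: power_add)
    finally show "coeff (q j) n = 1 / 2 ^ n"
      by (simp add: d power_one_over)
  qed
  show thesis
  proof
    show "poly p = jacobi_P a b n"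
      by (auto simp: fun_eq_iff p_def q_def jacobi_P_def poly_sum diff_divide_distrib
          add_divide_distrib mult_ac add.commute intro!: sum.cong)
    show "degree p \<le> n"
      unfolding p_def using q(1) by (intro degree_sum_le) (auto intro: order.trans[OF degree_smult_le])
    have "coeff p n = (\<Sum>j=0..n. ((real n + a) gchoose j) * ((real n + b) gchoose (n - j))) / 2 ^ n"
      by (simp add: p_def coeff_sum q(2) sum_divide_distrib)
    also have "\<dots> = ((2 * real n + a + b) gchoose n) / 2 ^ n"
      by (simp add: gbinomial_Vandermonde algebra_simps)
    finally show "coeff p n = ((2 * real n + a + b) gchoose n) / 2 ^ n" .
  qed
qed

text \<open>
  For \<open>i = 0\<close> the general formula may divide by zero, namely if \<open>a + b = -1\<close>; the affine quotient is
  then \<open>1\<close> by convention, and the normalizer is \<open>Beta (a + 1) (b + 1)\<close>.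
\<close>
lemma leading_coefficient_times_Beta:
  assumes "-1 < a" "-1 < b"
  shows "((2 * real i + a + b) gchoose i) * Beta (a + real i + 1) (b + real i + 1)
    = jacobi_normalizer a b i / affine_quotient 0 a b i"
proof (cases "i = 0")
  case True
  then show ?thesis
    by (simp add: jacobi_normalizer_def affine_quotient_def Beta_def add_ac)
next
  case False
  define z where "z = 2 * real i + a + b"
  define s where "s = real i + a + b + 1"
  have pos: "0 < s" "0 < z + 1"
    using assms False by (auto simp: z_def s_def)
  have lead: "z gchoose i = Gamma (z + 1) / (fact i * Gamma s)"
    using pos gbinomial_Gamma_pos[of z i] by (simp add: z_def s_def algebra_simps)
  have Beta: "Beta (a + real i + 1) (b + real i + 1)
      = Gamma (real i + a + 1) * Gamma (real i + b + 1) / ((z + 1) * Gamma (z + 1))"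
  proof -
    have "a + real i + 1 + (b + real i + 1) = z + 1 + 1"
      by (simp add: z_def)
    then show ?thesis
      using pos Gamma_plus1[of "z + 1"] pos_notin_nonpos_Ints[of "z + 1"]
      by (simp add: Beta_def add_ac)
  qed
  have Gamma: "Gamma (real i + a + b + 2) = s * Gamma s"
  proof -
    have s: "real i + a + b + 2 = s + 1"
      by (simp add: s_def)
    show ?thesis
      unfolding s using pos Gamma_plus1[of s] pos_notin_nonpos_Ints[of s] by simp
  qed
  have quotient: "affine_quotient 0 a b i = (z + 1) / s"
    using False by (simp add: affine_quotient_def z_def s_def)
  have "Gamma s \<noteq> 0" "Gamma (z + 1) \<noteq> 0"
    using pos by (auto intro!: Gamma_pos_nonzero)
  moreover have "u / (F * v) * (G / (y * u)) = G / (F * (s * v)) / (y / s)"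
    if "u \<noteq> 0" "v \<noteq> 0" "y \<noteq> 0" for u v y F G :: real
    using that pos by (simp add: field_simps)
  ultimately show ?thesis
    using pos unfolding z_def[symmetric] jacobi_normalizer_def lead Beta Gamma quotient by auto
qed

text \<open>
  Integration by parts with \<open>g = P\<^sub>i\<close> leaves the \<open>i\<close>-th derivative of a polynomial of degree at most \<open>i\<close>, a
  constant \<open>c\<close>, against the pure weight \<open>w (a + i) (b + i)\<close>.
\<close>
lemma jacobi_norm_squared:
  assumes "-1 < a" "-1 < b"
  shows "(jacobi_norm a b (jacobi_P a b i))\<^sup>2
    = 2 powr (a + b + 1) * jacobi_normalizer a b i / affine_quotient 0 a b i"
proof -
  obtain p where p: "poly p = jacobi_P a b i" "degree p \<le> i"
    and lc: "coeff p i = ((2 * real i + a + b) gchoose i) / 2 ^ i"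
    by (rule jacobi_P_as_poly)
  have "degree ((pderiv ^^ i) p) = 0"
    using p(2) by (simp add: degree_higher_pderiv)
  then obtain c where c: "(pderiv ^^ i) p = [:c:]"
    by (rule degree_eq_zeroE)
  then have "c = fact i * coeff p i"
    using coeff_higher_pderiv[of i p 0] by (simp add: pochhammer_fact)
  then have c': "c = fact i * ((2 * real i + a + b) gchoose i) / 2 ^ i"
    by (simp add: lc)
  have w: "integral {-1..1} (jacobi_weight (a + real i) (b + real i))
      = 2 powr (a + b + 1) * (2 ^ i * 2 ^ i) * Beta (a + real i + 1) (b + real i + 1)"
  proof -
    have "2 powr (a + real i + (b + real i) + 1) = 2 powr (a + b + 1) * (2 ^ i * 2 ^ i)"
      by (simp add: powr_realpow[symmetric] flip: powr_add) (simp add: algebra_simps)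
    then show ?thesis
      using has_integral_jacobi_weight[of "a + real i" "b + real i"] assms
      by (simp add: integral_unique)
  qed
  have "jacobi_inner a b (jacobi_P a b i) (jacobi_P a b i)
      = integral {-1..1} (\<lambda>t. jacobi_weight (a + real i) (b + real i) t * poly ((pderiv ^^ i) p) t)
        / (2 ^ i * fact i)"
    using jacobi_integration_by_parts[of a b i "\<lambda>k. poly ((pderiv ^^ k) p)"] assms p(1)
      continuous_on_poly[OF continuous_on_id, of "{-1..1}" "(pderiv ^^ i) p"]
    by (auto simp: jacobi_inner_def poly_DERIV intro!: integral_unique)
  also have "\<dots> = integral {-1..1} (jacobi_weight (a + real i) (b + real i)) * c / (2 ^ i * fact i)"
    by (simp add: c)
  also have "\<dots> = 2 powr (a + b + 1)
      * (((2 * real i + a + b) gchoose i) * Beta (a + real i + 1) (b + real i + 1))"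
    unfolding w c' by simp
  also have "\<dots> = 2 powr (a + b + 1) * jacobi_normalizer a b i / affine_quotient 0 a b i"
    unfolding leading_coefficient_times_Beta[OF assms] by simp
  finally have inner: "jacobi_inner a b (jacobi_P a b i) (jacobi_P a b i)
    = 2 powr (a + b + 1) * jacobi_normalizer a b i / affine_quotient 0 a b i" .
  have "0 \<le> jacobi_inner a b (jacobi_P a b i) (jacobi_P a b i)"
    unfolding jacobi_inner_def using assms
    by (intro integral_nonneg)
      (auto simp: mult.assoc jacobi_weight_nonneg
        intro!: jacobi_weight_times_continuous_integrable continuous_on_mult jacobi_P_continuous_on)
  then show ?thesis
    by (simp add: jacobi_norm_def inner)
qed

text \<open>
  The factor common to all means and the squared norm differ only by the affine quotient. With \<open>n = 0\<close>
  in \<open>affine_quotient\<close>, the exponents \<open>a\<close> and \<open>b\<close> are those of the inner product itself.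
\<close>
lemma jacobi_fourier_coefficient:
  assumes "-1 < a" "-1 < b" "continuous_on {-1..1} g"
  shows "jacobi_inner a b (jacobi_P a b i) g / (jacobi_norm a b (jacobi_P a b i))\<^sup>2
    = affine_quotient 0 a b i
      * (\<Sum>j=0..i. (-1) ^ (i + j) * real (i choose j) * jacobi_mean (a + real i - real j) (b + real j) g)"
proof -
  have "K * S / (K / r) = r * S" if "K \<noteq> 0" for K S r :: real
    using that by simp
  moreover have "2 powr (a + b + 1) * jacobi_normalizer a b i \<noteq> 0"
    using jacobi_normalizer_nonzero[OF assms(1,2)] by simp
  ultimately show ?thesis
    unfolding jacobi_norm_squared[OF assms(1,2)] jacobi_inner_def
      integral_jacobi_P_eq_alternating_means[OF assms] by blast
qed

section \<open>The minimal estimators as means of the derivative\<close>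

lemma shrink_interval_affine:
  assumes "x \<in> shrink_interval h I" "0 < h" "t \<in> {-1..1}"
  shows "x + h * t \<in> I"
proof -
  have "h * t \<le> h * 1"
    using assms(2,3) by (intro mult_left_mono) auto
  moreover have "h * (-1) \<le> h * t"
    using assms(2,3) by (intro mult_left_mono) auto
  ultimately have "x + h * t \<in> {x - h..x + h}"
    by simp
  then show ?thesis
    using assms(1) by (auto simp: shrink_interval_def)
qed

lemma Ck_on_has_derivative:
  assumes "Ck_on k f I" "x \<in> I" "j < k"
  shows "((deriv ^^ j) f has_real_derivative (deriv ^^ Suc j) f x) (at x)"
  using assms by (auto simp: Ck_on_def DERIV_deriv_iff_real_differentiable)

lemma Ck_on_rescaled_continuous:
  assumes "0 < h" "Ck_on (Suc n) f I" "x \<in> shrink_interval h I"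
  shows "continuous_on {-1..1} (\<lambda>t. (deriv ^^ n) f (x + h * t))"
proof -
  have "isCont (\<lambda>t. (deriv ^^ n) f (x + h * t)) t" if "t \<in> {-1..1}" for t
  proof (rule isCont_o2[where f = "\<lambda>t. x + h * t"])
    show "isCont (\<lambda>t. x + h * t) t"
      by simp
    show "isCont ((deriv ^^ n) f) (x + h * t)"
      using Ck_on_has_derivative[OF assms(2) shrink_interval_affine[OF assms(3,1) that], of n]
      by (auto intro: DERIV_isCont)
  qed
  then show ?thesis
    by (intro continuous_at_imp_continuous_on) auto
qed

text \<open>
  Integration by parts is applied to the derivatives of \<open>t \<mapsto> f (x + h t)\<close>. The \<open>n\<close>-th one brings a factor
  \<open>h\<^bsup>n\<^esup>\<close>, which the estimator divides out, and the constant in its kernel is chosen so that the remaining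
  weight has total mass one.
\<close>
lemma minimal_estimator_eq_jacobi_mean:
  assumes "-1 < \<alpha>" "-1 < \<beta>" "0 < h" "Ck_on (Suc n) f I" "x \<in> shrink_interval h I"
  shows "minimal_estimator n h \<alpha> \<beta> f x
    = jacobi_mean (\<alpha> + real n) (\<beta> + real n) (\<lambda>t. (deriv ^^ n) f (x + h * t))"
proof -
  define g where "g k t = h ^ k * (deriv ^^ k) f (x + h * t)" for k t
  define B where "B = Beta (real n + \<alpha> + 1) (real n + \<beta> + 1)"
  define c where "c = 2 powr (- (real n + \<alpha> + \<beta> + 1)) * fact n / B"
  define J where "J = integral {-1..1} (\<lambda>t. jacobi_weight (\<alpha> + real n) (\<beta> + real n) t
    * (deriv ^^ n) f (x + h * t))"
  have g_deriv: "(g k has_real_derivative g (Suc k) t) (at t)" if "k < n" "t \<in> {-1..1}" for k t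
  proof -
    have "((deriv ^^ k) f has_real_derivative (deriv ^^ Suc k) f (x + h * t)) (at (x + h * t))"
      using that assms by (intro Ck_on_has_derivative[OF assms(4)] shrink_interval_affine) auto
    moreover have "((\<lambda>t. x + h * t) has_real_derivative h) (at t)"
      by (auto intro!: derivative_eq_intros)
    ultimately have "((\<lambda>t. (deriv ^^ k) f (x + h * t)) has_real_derivative
        (deriv ^^ Suc k) f (x + h * t) * h) (at t)"
      by (rule DERIV_chain2)
    from DERIV_cmult[OF this, of "h ^ k"] show ?thesis
      by (simp add: g_def[abs_def] mult_ac)
  qed
  have "continuous_on {-1..1} (g n)"
    unfolding g_def using Ck_on_rescaled_continuous[OF assms(3-5)] by (intro continuous_intros)
  from jacobi_integration_by_parts[where g = g, OF assms(1,2) g_deriv this]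
  have "((\<lambda>t. jacobi_weight \<alpha> \<beta> t * jacobi_P \<alpha> \<beta> n t * f (x + h * t)) has_integral
      h ^ n * J / (2 ^ n * fact n)) {-1..1}"
    by (simp add: g_def J_def mult.left_commute[of _ "h ^ n"])
  from has_integral_mult_right[OF this, of c]
  have "integral {-1..1} (\<lambda>t. jacobi_rho n \<alpha> \<beta> t * f (x + h * t)) = c * (h ^ n * J / (2 ^ n * fact n))"
    by (intro integral_unique) (simp add: jacobi_rho_def c_def B_def mult_ac)
  then have "minimal_estimator n h \<alpha> \<beta> f x = c * J / (2 ^ n * fact n)"
    using assms(3) by (simp add: minimal_estimator_def)
  also have "\<dots> = J / (2 powr (real n + \<alpha> + \<beta> + 1) * 2 ^ n * B)"
    unfolding c_def powr_minus_divide by simp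
  also have "2 powr (real n + \<alpha> + \<beta> + 1) * 2 ^ n = 2 powr (\<alpha> + real n + (\<beta> + real n) + 1)"
    by (simp add: powr_realpow[symmetric] flip: powr_add) (simp add: algebra_simps)
  finally show ?thesis
    by (simp add: jacobi_mean_def J_def B_def add_ac)
qed

section \<open>Affine estimators as combinations of minimal estimators\<close>

theorem proposition8:
  fixes I :: "real set" and n q :: nat and \<alpha> \<beta> h :: real and f :: "real \<Rightarrow> real"
  assumes "open I" and "is_interval I"
    and "\<alpha> > -1" and "\<beta> > -1"
    and "h > 0"
    and "Ck_on (n + 1) f I"
  shows "(\<forall>x\<in>shrink_interval h I.
            affine_estimator n h \<alpha> \<beta> q f x =
              (\<Sum>i=0..q. jacobi_P (\<alpha> + real n) (\<beta> + real n) i 0 * affine_quotient n \<alpha> \<beta> i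
                 * (\<Sum>j=0..i. (-1) ^ (i + j) * real (i choose j)
                      * minimal_estimator n h (\<alpha> + real i - real j) (\<beta> + real j) f x)))
       \<and> (\<Sum>i=0..q. jacobi_P (\<alpha> + real n) (\<beta> + real n) i 0 * affine_quotient n \<alpha> \<beta> i
              * (\<Sum>j=0..i. (-1) ^ (i + j) * real (i choose j))) = 1"
proof (intro conjI ballI)
  fix x assume x: "x \<in> shrink_interval h I"
  let ?a = "\<alpha> + real n" and ?b = "\<beta> + real n"
  let ?g = "\<lambda>t. (deriv ^^ n) f (x + h * t)"
  have Ck: "Ck_on (Suc n) f I"
    using assms(6) by simp
  \<comment> \<open>The shift of both exponents by \<open>n\<close> accounts for the \<open>2n\<close> in the quotient.\<close>
  have quotient: "affine_quotient 0 ?a ?b i = affine_quotient n \<alpha> \<beta> i" for i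
    by (simp add: affine_quotient_def algebra_simps)
  have "minimal_estimator n h (\<alpha> + real i - real j) (\<beta> + real j) f x
      = jacobi_mean (?a + real i - real j) (?b + real j) ?g" if "j \<le> i" for i j
    using minimal_estimator_eq_jacobi_mean[of "\<alpha> + real i - real j" "\<beta> + real j", OF _ _ assms(5) Ck x]
      that assms(3,4) by (simp add: algebra_simps)
  moreover have "jacobi_inner ?a ?b (jacobi_P ?a ?b i) ?g / (jacobi_norm ?a ?b (jacobi_P ?a ?b i))\<^sup>2
      = affine_quotient n \<alpha> \<beta> i
        * (\<Sum>j=0..i. (-1) ^ (i + j) * real (i choose j) * jacobi_mean (?a + real i - real j) (?b + real j) ?g)"
    for i
    using jacobi_fourier_coefficient[of ?a ?b ?g i] Ck_on_rescaled_continuous[OF assms(5) Ck x]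
      assms(3,4) by (simp add: quotient)
  ultimately show "affine_estimator n h \<alpha> \<beta> q f x =
      (\<Sum>i=0..q. jacobi_P ?a ?b i 0 * affine_quotient n \<alpha> \<beta> i
         * (\<Sum>j=0..i. (-1) ^ (i + j) * real (i choose j)
              * minimal_estimator n h (\<alpha> + real i - real j) (\<beta> + real j) f x))"
    by (simp add: affine_estimator_def mult_ac)
next
  have "(\<Sum>j=0..i. (-1) ^ (i + j) * real (i choose j)) = (if i = 0 then 1 else 0)" for i
  proof -
    have "(\<Sum>j=0..i. (-1) ^ (i + j) * real (i choose j))
        = (-1) ^ i * (\<Sum>j\<le>i. (-1) ^ j * real (i choose j))"
      by (simp add: power_add sum_distrib_left mult.assoc atMost_atLeast0)
    then show ?thesis
      using choose_alternating_sum[of i, where 'a = real] by auto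
  qed
  then have "jacobi_P (\<alpha> + real n) (\<beta> + real n) i 0 * affine_quotient n \<alpha> \<beta> i
      * (\<Sum>j=0..i. (-1) ^ (i + j) * real (i choose j)) = (if i = 0 then 1 else 0)" for i
    by (simp add: jacobi_P_def affine_quotient_def)
  then show "(\<Sum>i=0..q. jacobi_P (\<alpha> + real n) (\<beta> + real n) i 0 * affine_quotient n \<alpha> \<beta> i
      * (\<Sum>j=0..i. (-1) ^ (i + j) * real (i choose j))) = 1"
    by simp
qed

end
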